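(* Let $V\subset A=A_n$ be the span of the elements of $A_n$ of degree $\leq 1$. Then for every $i\ge 1$, $$N_i = V\cdot L_i/(A\cdot L_{i+1}\cap V\cdot L_i),$$ i.e. the inclusion $V\cdot L_i\subset M_i$ induces an isomorphism of vector spaces $V\cdot L_i/(A\cdot L_{i+1}\cap V\cdot L_i)\to M_i/M_{i+1}=N_i$.
   Context: Let $A=A_n=\mathbb{C}\langle x_1,\ldots,x_n\rangle$ be the free associative unital algebra on $n$ generators, graded by $\deg x_i=1$. Define $L_1=A$ and $L_{i+1}=[A,L_i]$ (linear span of commutators), $M_i=A L_i A$ (the two-sided ideal generated by $L_i$, which equals $A\cdot L_i$), and $N_i=M_i/M_{i+1}$. For subspaces $X,Y\subset A$, $X\cdot Y$ denotes the linear span of the products $xy$ with $x\in X$, $y\in Y$. Thus $V$ is spanned by $1,x_1,\ldots,x_n$. *)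

theory Defs
  imports Complex_Main "HOL-Library.Poly_Mapping" "HOL-Library.Set_Algebras"
begin

subsection \<open>The free algebra\<close>

text \<open>
  Words over \<open>'n\<close> are the free monoid on \<open>'n\<close>, written additively because the convolution
  product of the theory of finitely supported functions is indexed by an additive monoid.
  So \<open>'n falg\<close> is the monoid algebra of the free monoid over the complex numbers,
  i.e. the free associative unital algebra with one generator for each element of \<open>'n\<close>;
  for finite \<open>'n\<close> it is \<open>A\<^sub>n\<close> with \<open>n = CARD('n)\<close>. The whole algebra is \<open>UNIV\<close>.
\<close>

datatype 'n word = Word (letters: "'n list")

instantiation word :: (type) monoid_add
begin

definition zero_word :: "'a word" where "0 = Word []"

definition plus_word :: "'a word \<Rightarrow> 'a word \<Rightarrow> 'a word"
  where "u + v = Word (letters u @ letters v)"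

instance
  by standard (simp_all add: zero_word_def plus_word_def)

end

type_synonym 'n falg = "'n word \<Rightarrow>\<^sub>0 complex"

definition gen :: "'n \<Rightarrow> 'n falg"
  where "gen x = Poly_Mapping.single (Word [x]) 1"

definition falg_scale :: "complex \<Rightarrow> 'n falg \<Rightarrow> 'n falg"
  where "falg_scale c f = Poly_Mapping.map ((*) c) f"

lemma lookup_falg_scale [simp]:
  "Poly_Mapping.lookup (falg_scale c f) w = c * Poly_Mapping.lookup f w"
  by (simp add: falg_scale_def Poly_Mapping.map.rep_eq when_def)

global_interpretation falg: vector_space falg_scale
  by standard (rule poly_mapping_eqI, simp add: lookup_add algebra_simps)+

text \<open>The degree of 0 is set to 0.\<close>

definition falg_degree :: "'n falg \<Rightarrow> nat"
  where "falg_degree f = Max (insert 0 ((\<lambda>w. length (letters w)) ` Poly_Mapping.keys f))"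

subsection \<open>The lower central series and its associated ideals\<close>

text \<open>
  \<open>X * Y\<close> below is the elementwise product of sets.
\<close>

definition span_prod :: "'n falg set \<Rightarrow> 'n falg set \<Rightarrow> 'n falg set"  (infixl \<open>\<odot>\<close> 70)
  where "X \<odot> Y = falg.span (X * Y)"

definition commutator :: "'n falg \<Rightarrow> 'n falg \<Rightarrow> 'n falg"
  where "commutator a b = a * b - b * a"

text \<open>The series is indexed from 1; the value at 0 is a dummy.\<close>

fun falg_L :: "nat \<Rightarrow> 'n falg set"
  where
    "falg_L 0 = UNIV"
  | "falg_L (Suc 0) = UNIV"
  | "falg_L (Suc (Suc i)) = falg.span {commutator a b | a b. a \<in> UNIV \<and> b \<in> falg_L (Suc i)}"

definition falg_M :: "nat \<Rightarrow> 'n falg set"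
  where "falg_M i = UNIV \<odot> falg_L i \<odot> UNIV"

definition falg_V :: "'n falg set"
  where "falg_V = falg.span {f. falg_degree f \<le> 1}"

subsection \<open>Quotient spaces\<close>

text \<open>
  \<open>quotient_space X U\<close> is the set of cosets \<open>x + U\<close>. Its addition is the elementwise
  sum of cosets. The multiples \<open>c p\<close> of the elements of a coset \<open>P\<close> form a coset only for
  nonzero \<open>c\<close>; adding \<open>U\<close> makes the scalar multiplication correct for all \<open>c\<close>.
\<close>

definition quotient_space :: "'n falg set \<Rightarrow> 'n falg set \<Rightarrow> 'n falg set set"
  where "quotient_space X U = (\<lambda>x. x +o U) ` X"

definition quotient_scale :: "'n falg set \<Rightarrow> complex \<Rightarrow> 'n falg set \<Rightarrow> 'n falg set"
  where "quotient_scale U c P = falg_scale c ` P + U"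

definition quotient_iso ::
    "'n falg set \<Rightarrow> 'n falg set \<Rightarrow> 'n falg set \<Rightarrow> 'n falg set \<Rightarrow> ('n falg set \<Rightarrow> 'n falg set) \<Rightarrow> bool"
  where "quotient_iso X U Y W \<phi> \<longleftrightarrow>
    bij_betw \<phi> (quotient_space X U) (quotient_space Y W) \<and>
    (\<forall>P\<in>quotient_space X U. \<forall>Q\<in>quotient_space X U. \<phi> (P + Q) = \<phi> P + \<phi> Q) \<and>
    (\<forall>c. \<forall>P\<in>quotient_space X U. \<phi> (quotient_scale U c P) = quotient_scale W c (\<phi> P))"

lemma quotient_space_add:
  assumes "falg.subspace U"
  shows "(x +o U) + (y +o U) = (x + y) +o U"
proof -
  have "U + U = U"
    using falg.subspace_add[OF assms] falg.subspace_0[OF assms]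
    by (force simp: set_plus_def)
  then show ?thesis
    by (simp add: set_plus_rearrange)
qed

lemma quotient_space_scale:
  assumes "falg.subspace U"
  shows "quotient_scale U c (x +o U) = falg_scale c x +o U"
proof (intro set_eqI iffI)
  fix z
  assume "z \<in> quotient_scale U c (x +o U)"
  then obtain u v where "u \<in> U" "v \<in> U" "z = falg_scale c (x + u) + v"
    by (auto simp: quotient_scale_def set_plus_def elt_set_plus_def)
  then show "z \<in> falg_scale c x +o U"
    using falg.subspace_add[OF assms] falg.subspace_scale[OF assms]
    by (auto simp: elt_set_plus_def falg.scale_right_distrib add.assoc)
next
  fix z
  assume "z \<in> falg_scale c x +o U"
  then obtain v where v: "v \<in> U" "z = falg_scale c x + v"
    by (auto simp: elt_set_plus_def)
  have "x \<in> x +o U"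
    using falg.subspace_0[OF assms] by (auto simp: elt_set_plus_def)
  with v show "z \<in> quotient_scale U c (x +o U)"
    by (auto simp: quotient_scale_def set_plus_def)
qed

subsection \<open>Inclusions and the description of \<open>falg_V\<close> by generators\<close>

lemma falg_L_subset: "falg_L (Suc i) \<subseteq> falg_L i"
proof (induction i)
  case (Suc i)
  then show ?case
    by (cases i) (simp, simp only: falg_L.simps, intro falg.span_mono, blast)
qed simp

lemma falg_M_subset: "falg_M (Suc i) \<subseteq> falg_M i"
  unfolding falg_M_def span_prod_def
  by (intro falg.span_mono set_times_mono2 falg_L_subset order_refl)

lemma letters_zero [simp]: "letters (0 :: 'n word) = []"
  by (simp add: zero_word_def)

lemma falg_degree_le_1_iff:
  "falg_degree f \<le> 1 \<longleftrightarrow> (\<forall>w\<in>Poly_Mapping.keys f. length (letters w) \<le> 1)"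
  by (simp add: falg_degree_def)

lemma falg_V_eq: "falg_V = falg.span (insert 1 (range gen))"
proof
  have "f \<in> falg.span (insert 1 (range gen))" if "falg_degree f \<le> 1" for f :: "'n falg"
  proof -
    have "Poly_Mapping.single w (Poly_Mapping.lookup f w) \<in> falg.span (insert 1 (range gen))"
      if w: "w \<in> Poly_Mapping.keys f" for w
    proof -
      have eq: "Poly_Mapping.single w c = falg_scale c (Poly_Mapping.single w 1)" for c
        by (rule poly_mapping_eqI) (simp add: lookup_single when_def)
      have "length (letters w) \<le> 1"
        using w \<open>falg_degree f \<le> 1\<close> unfolding falg_degree_le_1_iff by blast
      then have "w = 0 \<or> (\<exists>x. w = Word [x])"
        by (cases w; cases "letters w") (auto simp: zero_word_def)
      then have "Poly_Mapping.single w (1 :: complex) \<in> insert 1 (range gen)"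
        by (auto simp: gen_def)
      then show ?thesis
        by (subst eq) (intro falg.span_scale falg.span_base)
    qed
    then have "(\<Sum>w\<in>Poly_Mapping.keys f. Poly_Mapping.single w (Poly_Mapping.lookup f w))
        \<in> falg.span (insert 1 (range gen))"
      by (rule falg.span_sum)
    moreover have "(\<Sum>w\<in>Poly_Mapping.keys f. Poly_Mapping.single w (Poly_Mapping.lookup f w)) = f"
      by (rule poly_mapping_eqI)
        (simp add: lookup_sum lookup_single when_def in_keys_iff sum.delta)
    ultimately show ?thesis
      by simp
  qed
  then show "falg_V \<subseteq> falg.span (insert 1 (range gen))"
    unfolding falg_V_def by (intro falg.span_minimal falg.subspace_span) auto
  show "falg.span (insert 1 (range gen)) \<subseteq> (falg_V :: 'n falg set)"
    unfolding falg_V_def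
    by (intro falg.span_mono)
      (auto simp: falg_degree_le_1_iff gen_def simp del: One_nat_def simp flip: single_one)
qed

end

theory Submission
  imports Defs
begin

text \<open>
  By the second isomorphism theorem everything reduces to
  \<open>A \<cdot> L\<^sub>i = V \<cdot> L\<^sub>i + A \<cdot> L\<^bsub>i+1\<^esub>\<close>, once the two-sided ideal \<open>M\<^sub>i\<close> is known to be
  \<open>A \<cdot> L\<^sub>i\<close> (moving a right factor past an element of \<open>L\<^sub>i\<close> costs a commutator in
  \<open>L\<^bsub>i+1\<^esub> \<subseteq> L\<^sub>i\<close>). For \<open>i = 1\<close> it holds since \<open>1 \<in> V\<close>. For \<open>i \<ge> 2\<close> the left-hand side is
  spanned by the elements \<open>a[b,l]\<close> with \<open>l \<in> L\<^bsub>i-1\<^esub>\<close>. Modulo \<open>A \<cdot> L\<^bsub>i+1\<^esub>\<close>, elements of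
  \<open>L\<^sub>i\<close> commute with everything, so the Leibniz rule has two consequences:

  \<^item> \<open>a[b,l] + b[a,l] \<equiv> [ab,l]\<close>, which lies in \<open>L\<^sub>i\<close>; hence \<open>a[b,l]\<close> is skew in \<open>a\<close> and \<open>b\<close>
    modulo \<open>V \<cdot> L\<^sub>i + A \<cdot> L\<^bsub>i+1\<^esub>\<close>;
  \<^item> \<open>a[bc,l] \<equiv> ab[c,l] + ac[b,l]\<close>; hence it suffices to treat \<open>a[x,l]\<close> with \<open>x\<close> a generator
    and \<open>a\<close> arbitrary.

  By skewness \<open>a[x,l]\<close> may be replaced by \<open>-x[a,l]\<close>, which lies in \<open>V \<cdot> L\<^sub>i\<close>: exchanging the
  two slots moves the generator to the outside, and the factor of unbounded degree disappears
  into the commutator.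
\<close>

section \<open>Algebra structure and induction over the free algebra\<close>

lemma falg_scale_eq_mult: "falg_scale c f = Poly_Mapping.single 0 c * f"
  unfolding falg_scale_def by (rule mult_map_scale_conv_mult)

lemma falg_expand:
  "(\<Sum>w\<in>Poly_Mapping.keys f. Poly_Mapping.single w (Poly_Mapping.lookup f w)) = f"
  by (rule poly_mapping_eqI)
    (simp add: lookup_sum lookup_single when_def in_keys_iff sum.delta)

lemma falg_scale_mult_left: "falg_scale c f * g = falg_scale c (f * g)"
  by (simp add: falg_scale_eq_mult mult.assoc)

lemma single_zero_central: "f * Poly_Mapping.single 0 c = Poly_Mapping.single 0 c * (f :: 'n falg)"
proof -
  let ?S = "\<Sum>w\<in>Poly_Mapping.keys f. Poly_Mapping.single w (Poly_Mapping.lookup f w)"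
  have "?S * Poly_Mapping.single 0 c = Poly_Mapping.single 0 c * ?S"
    by (simp add: sum_distrib_left sum_distrib_right mult_single mult.commute)
  then show ?thesis
    by (simp only: falg_expand)
qed

lemma falg_scale_mult_right: "f * falg_scale c g = falg_scale c (f * g)"
  by (simp add: falg_scale_eq_mult single_zero_central flip: mult.assoc)

lemma falg_induct [case_names one gen add scale mult]:
  fixes f :: "'n falg"
  assumes one: "P 1"
    and gen: "\<And>x. P (gen x)"
    and add: "\<And>f g. P f \<Longrightarrow> P g \<Longrightarrow> P (f + g)"
    and scale: "\<And>c f. P f \<Longrightarrow> P (falg_scale c f)"
    and mult: "\<And>f g. P f \<Longrightarrow> P g \<Longrightarrow> P (f * g)"
  shows "P f"
proof -
  have word: "P (Poly_Mapping.single (Word xs) 1)" for xs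
  proof (induction xs)
    case Nil
    then show ?case using one by (simp flip: zero_word_def)
  next
    case (Cons x xs)
    have "Poly_Mapping.single (Word (x # xs)) 1 = gen x * Poly_Mapping.single (Word xs) 1"
      by (simp add: gen_def mult_single plus_word_def)
    then show ?case using mult gen Cons by simp
  qed
  have zero: "P 0"
    using scale[OF one, of 0] by simp
  have "P (Poly_Mapping.single w c)" for w c
  proof -
    have "Poly_Mapping.single w c = falg_scale c (Poly_Mapping.single (Word (letters w)) 1)"
      by (rule poly_mapping_eqI) (simp add: lookup_single when_def)
    then show ?thesis using scale[OF word] by metis
  qed
  then have "P (\<Sum>w\<in>K. Poly_Mapping.single w (Poly_Mapping.lookup f w))" for K
    by (induction K rule: infinite_finite_induct) (simp_all add: zero add)
  then show ?thesis
    by (metis falg_expand)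
qed

lemma commutator_add_left: "commutator (f + g) h = commutator f h + commutator g h"
  by (simp add: commutator_def algebra_simps)

lemma commutator_scale_left: "commutator (falg_scale c f) h = falg_scale c (commutator f h)"
  by (simp add: commutator_def falg_scale_mult_left falg_scale_mult_right falg.scale_right_diff_distrib)

lemma commutator_mult_left: "commutator (f * g) h = f * commutator g h + commutator f h * g"
  by (simp add: commutator_def algebra_simps)

section \<open>Products of subspaces\<close>

lemma subspace_span_prod: "falg.subspace (X \<odot> Y)"
  by (simp add: span_prod_def)

lemma span_prod_mem: "x \<in> X \<Longrightarrow> y \<in> Y \<Longrightarrow> x * y \<in> X \<odot> Y"
  unfolding span_prod_def by (intro falg.span_base) (auto simp: set_times_def)

lemma span_prod_subset:
  assumes "falg.subspace S" "\<And>x y. x \<in> X \<Longrightarrow> y \<in> Y \<Longrightarrow> x * y \<in> S"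
  shows "X \<odot> Y \<subseteq> S"
  unfolding span_prod_def using assms by (intro falg.span_minimal) (auto elim!: set_times_elim)

lemma subspace_set_plus:
  assumes "falg.subspace X" "falg.subspace W"
  shows "falg.subspace (X + W)"
proof -
  have "X + W = {x + y |x y. x \<in> X \<and> y \<in> W}"
    by (auto simp: set_plus_def)
  then show ?thesis
    using falg.subspace_sums[OF assms] by simp
qed

lemma set_plus_left_mem: "falg.subspace W \<Longrightarrow> x \<in> X \<Longrightarrow> x \<in> X + W"
  using set_plus_intro[of x X 0 W] by (simp add: falg.subspace_0)

lemma set_plus_right_mem: "falg.subspace X \<Longrightarrow> w \<in> W \<Longrightarrow> w \<in> X + W"
  using set_plus_intro[of 0 X w W] by (simp add: falg.subspace_0)

section \<open>The ideals \<open>M\<^sub>i\<close> as one-sided products\<close>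

lemma commutator_in_L:
  assumes "i \<ge> 1" "l \<in> falg_L i"
  shows "commutator a l \<in> falg_L (Suc i)"
  using assms by (cases i) (auto intro!: falg.span_base)

text \<open>
  This is the form in which centrality of \<open>L\<^sub>i\<close> modulo \<open>A \<cdot> L\<^bsub>i+1\<^esub>\<close> is used: the commutator
  arises to the right of an arbitrary factor \<open>a\<close>, so the left ideal \<open>A \<cdot> L\<^bsub>i+1\<^esub>\<close> absorbs it.
  It yields both the two-sidedness of \<open>A \<cdot> L\<^sub>i\<close> and the Leibniz rule with all coefficients on
  the left.
\<close>

lemma L_central_mod_next:
  assumes "i \<ge> 1" "l \<in> falg_L i"
  shows "a * l * b - a * b * l \<in> UNIV \<odot> falg_L (Suc i)"
proof -
  have "a * l * b - a * b * l = - a * commutator b l"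
    by (simp add: commutator_def algebra_simps)
  then show ?thesis
    using commutator_in_L[OF assms] by (metis UNIV_I span_prod_mem)
qed

lemma falg_M_eq:
  assumes "i \<ge> 1"
  shows "falg_M i = UNIV \<odot> falg_L i"
proof
  let ?AL = "UNIV \<odot> falg_L i :: 'a falg set"
  have sub: "falg.subspace ?AL"
    by (rule subspace_span_prod)
  have "?AL \<subseteq> {f. \<forall>v. f * v \<in> ?AL}"
  proof (rule span_prod_subset)
    show "falg.subspace {f. \<forall>v. f * v \<in> ?AL}"
      using sub by (simp add: falg.subspace_def distrib_right falg_scale_mult_left)
  next
    fix a l :: "'a falg"
    assume l: "l \<in> falg_L i"
    have "a * l * v \<in> ?AL" for v
    proof -
      have "a * l * v - a * v * l \<in> UNIV \<odot> falg_L (Suc i)"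
        using assms l by (rule L_central_mod_next)
      also have "\<dots> \<subseteq> ?AL"
        unfolding span_prod_def
        by (intro falg.span_mono set_times_mono2 falg_L_subset order_refl)
      finally have "(a * l * v - a * v * l) + a * v * l \<in> ?AL"
        using l by (intro falg.subspace_add[OF sub] span_prod_mem) auto
      then show ?thesis by simp
    qed
    then show "a * l \<in> {f. \<forall>v. f * v \<in> ?AL}"
      by simp
  qed
  then show "falg_M i \<subseteq> ?AL"
    unfolding falg_M_def by (intro span_prod_subset[OF sub]) auto
  show "?AL \<subseteq> falg_M i"
    unfolding falg_M_def using span_prod_mem[of _ ?AL 1 UNIV] by auto
qed

declare falg_L.simps(3) [simp del]

section \<open>Reduction of the left factor to degree at most one\<close>

lemma one_in_V: "1 \<in> falg_V"
  unfolding falg_V_eq by (intro falg.span_base) simp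

lemma gen_in_V: "gen x \<in> falg_V"
  unfolding falg_V_eq by (intro falg.span_base) simp

lemma subspace_VL_plus_AL: "falg.subspace (falg_V \<odot> falg_L i + UNIV \<odot> falg_L (Suc i))"
  by (intro subspace_set_plus subspace_span_prod)

text \<open>
  The sum below is \<open>[ab,l]\<close> up to the position of the factor \<open>b\<close> relative to \<open>[a,l]\<close>.
\<close>

lemma skew_mod_VL_plus_AL:
  assumes "j \<ge> 1" "l \<in> falg_L j"
  shows "a * commutator b l + b * commutator a l
           \<in> falg_V \<odot> falg_L (Suc j) + UNIV \<odot> falg_L (Suc (Suc j))"
proof -
  have "1 * commutator (a * b) l \<in> falg_V \<odot> falg_L (Suc j)"
    by (intro span_prod_mem one_in_V commutator_in_L assms)
  moreover have "1 * commutator b (commutator a l) \<in> UNIV \<odot> falg_L (Suc (Suc j))"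
    by (intro span_prod_mem commutator_in_L assms) auto
  ultimately have "1 * commutator (a * b) l + 1 * commutator b (commutator a l)
      \<in> falg_V \<odot> falg_L (Suc j) + UNIV \<odot> falg_L (Suc (Suc j))"
    by (rule set_plus_intro)
  also have "1 * commutator (a * b) l + 1 * commutator b (commutator a l)
      = a * commutator b l + b * commutator a l"
    by (simp add: commutator_def algebra_simps)
  finally show ?thesis .
qed

text \<open>
  The induction runs over the element \<open>b\<close> inside the commutator, not over the factor \<open>a\<close> that is
  to be lowered: the Leibniz rule breaks up \<open>b\<close> while \<open>a\<close> grows, and skewness trades the two places
  when \<open>b\<close> has become a generator.
\<close>

lemma mult_commutator_in_VL_plus_AL:
  assumes j: "j \<ge> 1" and l: "l \<in> falg_L j"
  shows "a * commutator b l \<in> falg_V \<odot> falg_L (Suc j) + UNIV \<odot> falg_L (Suc (Suc j))"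
    (is "_ \<in> ?S")
proof (induction b arbitrary: a rule: falg_induct)
  case one
  then show ?case
    using falg.subspace_0[OF subspace_VL_plus_AL] by (simp add: commutator_def)
next
  case (gen x)
  have "gen x * commutator a l \<in> ?S"
    by (intro set_plus_left_mem subspace_span_prod span_prod_mem gen_in_V commutator_in_L j l)
  then have "(a * commutator (gen x) l + gen x * commutator a l) - gen x * commutator a l \<in> ?S"
    by (intro falg.subspace_diff[OF subspace_VL_plus_AL] skew_mod_VL_plus_AL j l)
  then show ?case by simp
next
  case (add b c)
  then show ?case
    by (simp add: commutator_add_left distrib_left falg.subspace_add[OF subspace_VL_plus_AL])
next
  case (scale r b)
  then show ?case
    by (simp add: commutator_scale_left falg_scale_mult_right
        falg.subspace_scale[OF subspace_VL_plus_AL])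
next
  case (mult b c)
  have "a * commutator b l * c - a * c * commutator b l \<in> ?S"
    by (intro set_plus_right_mem subspace_span_prod L_central_mod_next commutator_in_L j l) simp
  then have "a * b * commutator c l + a * c * commutator b l
      + (a * commutator b l * c - a * c * commutator b l) \<in> ?S"
    using mult by (intro falg.subspace_add[OF subspace_VL_plus_AL])
  then show ?case
    by (simp add: commutator_mult_left distrib_left mult.assoc)
qed

lemma falg_M_eq_VL_plus_M:
  assumes "i \<ge> 1"
  shows "falg_M i = falg_V \<odot> falg_L i + falg_M (Suc i)"
proof
  let ?S = "falg_V \<odot> falg_L i + UNIV \<odot> falg_L (Suc i) :: 'a falg set"
  have "a * m \<in> ?S" if m: "m \<in> falg_L i" for a m
  proof (cases "i = 1")
    case True
    have "1 * (a * m) \<in> falg_V \<odot> falg_L i"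
      using True by (intro span_prod_mem one_in_V) simp
    then show ?thesis
      by (simp add: set_plus_left_mem subspace_span_prod)
  next
    case False
    then obtain k where i: "i = Suc (Suc k)"
      using assms by (metis One_nat_def Suc_le_D nat.exhaust)
    define T where "T = {m. a * m \<in> ?S}"
    have "falg.subspace T"
      using subspace_VL_plus_AL[of i]
      unfolding T_def falg.subspace_def by (auto simp: distrib_left falg_scale_mult_right)
    moreover have "commutator b l \<in> T" if "l \<in> falg_L (Suc k)" for b l
      using mult_commutator_in_VL_plus_AL[OF _ that] by (simp add: T_def i)
    ultimately have "falg_L i \<subseteq> T"
      unfolding i falg_L.simps(3) by (intro falg.span_minimal) auto
    with m show ?thesis by (auto simp: T_def)
  qed
  then have "UNIV \<odot> falg_L i \<subseteq> ?S"
    by (intro span_prod_subset subspace_VL_plus_AL)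
  then show "falg_M i \<subseteq> falg_V \<odot> falg_L i + (falg_M (Suc i) :: 'a falg set)"
    using assms by (simp add: falg_M_eq)
next
  have sub: "falg.subspace (falg_M i :: 'a falg set)"
    unfolding falg_M_def by (rule subspace_span_prod)
  have "falg_V \<odot> falg_L i \<subseteq> (falg_M i :: 'a falg set)"
    using assms by (intro span_prod_subset sub) (simp add: falg_M_eq span_prod_mem)
  then show "falg_V \<odot> falg_L i + falg_M (Suc i) \<subseteq> (falg_M i :: 'a falg set)"
    using falg_M_subset[of i] by (auto elim!: set_plus_elim intro: falg.subspace_add[OF sub])
qed

section \<open>The second isomorphism theorem\<close>

lemma coset_plus_subspace:
  assumes "falg.subspace W" "falg.subspace X"
  shows "(x +o (W \<inter> X)) + W = x +o W"
proof -
  have "W \<inter> X + W = W"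
    using falg.subspace_add[OF assms(1)] falg.subspace_0[OF assms(1)] falg.subspace_0[OF assms(2)]
    by (force simp: set_plus_def)
  then show ?thesis
    by (simp add: set_plus_rearrange3)
qed

lemma coset_eq_iff:
  assumes "falg.subspace W"
  shows "x +o W = y +o W \<longleftrightarrow> x - y \<in> W"
proof
  assume "x +o W = y +o W"
  moreover have "x \<in> x +o W"
    using falg.subspace_0[OF assms] by (auto simp: elt_set_plus_def)
  ultimately show "x - y \<in> W"
    by (auto simp: elt_set_plus_def)
next
  assume xy: "x - y \<in> W"
  have "x + w \<in> y +o W" if "w \<in> W" for w
    using set_plus_intro2[OF falg.subspace_add[OF assms xy that], of y]
    by (simp add: algebra_simps)
  moreover have "y + w \<in> x +o W" if "w \<in> W" for w
    using set_plus_intro2[OF falg.subspace_diff[OF assms that xy], of x]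
    by (simp add: algebra_simps)
  ultimately show "x +o W = y +o W"
    by (auto simp: elt_set_plus_def)
qed

lemma second_isomorphism:
  assumes X: "falg.subspace X" and W: "falg.subspace W"
  shows "quotient_iso X (W \<inter> X) (X + W) W (\<lambda>P. P + W)"
proof -
  have WX: "falg.subspace (W \<inter> X)"
    using W X by (rule falg.subspace_inter)
  note coset = coset_plus_subspace[OF W X]
  have inj: "inj_on (\<lambda>P. P + W) (quotient_space X (W \<inter> X))"
    by (auto simp: inj_on_def quotient_space_def coset coset_eq_iff[OF W] coset_eq_iff[OF WX]
        intro: falg.subspace_diff[OF X])
  have absorb: "(x + w) +o W = x +o W" if "w \<in> W" for x w
    using that by (simp add: coset_eq_iff[OF W])
  have "(\<lambda>P. P + W) ` quotient_space X (W \<inter> X) = (\<lambda>x. x +o W) ` X"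
    by (simp add: quotient_space_def image_image coset)
  also have "\<dots> = quotient_space (X + W) W"
    using set_plus_left_mem[OF W]
    by (fastforce simp: quotient_space_def absorb elim!: set_plus_elim)
  finally have "bij_betw (\<lambda>P. P + W) (quotient_space X (W \<inter> X)) (quotient_space (X + W) W)"
    using inj by (simp add: bij_betw_def)
  then show ?thesis
    by (auto simp: quotient_iso_def quotient_space_def coset quotient_space_add[OF W]
        quotient_space_add[OF WX] quotient_space_scale[OF W] quotient_space_scale[OF WX])
qed

section \<open>The isomorphism onto \<open>N\<^sub>i\<close>\<close>

theorem theorem1p2:
  fixes i :: nat
  assumes "i \<ge> 1"
  shows "let VL = (falg_V :: 'n::finite falg set) \<odot> falg_L i;
             U = (UNIV \<odot> falg_L (i + 1)) \<inter> VL
         in VL \<subseteq> falg_M i \<and>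
            (\<exists>\<phi>. quotient_iso VL U (falg_M i) (falg_M (i + 1)) \<phi> \<and>
                 (\<forall>x\<in>VL. \<phi> (x +o U) = x +o falg_M (i + 1)))"
proof -
  define VL where "VL = (falg_V :: 'n falg set) \<odot> falg_L i"
  define W where "W = (falg_M (i + 1) :: 'n falg set)"
  have VL: "falg.subspace VL" and W: "falg.subspace W"
    unfolding VL_def W_def falg_M_def by (rule subspace_span_prod)+
  have M: "falg_M i = VL + W"
    using falg_M_eq_VL_plus_M[OF assms] by (simp add: VL_def W_def)
  have AL: "UNIV \<odot> falg_L (i + 1) = W"
    unfolding W_def by (simp add: falg_M_eq)
  have "VL \<subseteq> falg_M i"
    unfolding M using set_plus_left_mem[OF W] by blast
  moreover have "quotient_iso VL (W \<inter> VL) (falg_M i) W (\<lambda>P. P + W)"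
    unfolding M using VL W by (rule second_isomorphism)
  ultimately show ?thesis
    using coset_plus_subspace[OF W VL]
    unfolding Let_def AL VL_def[symmetric] W_def[symmetric] by blast
qed

end
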